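(* Let $\mu_1,\mu_2:\mathcal{C}\to\mathbb{R}_0^+$ and $\nu:\mathcal{E}\to\mathbb{R}_0^+$ be set functions vanishing on the empty set, and let $f:S\to\mathbb{R}_0^+$ be $\mu_i$-measurable for $i=1,2$. If $A\in\mathcal{C}$ is such that $f\in G_{RL}(\nu,\mu_i,A)$ for $i=1,2$, then $f\in G_{RL}(\nu,\mu_1+\mu_2,A)$ and $$\int_A^{*} f\,d(\nu,\mu_1+\mu_2)=\int_A^{*} f\,d(\nu,\mu_1)+\int_A^{*} f\,d(\nu,\mu_2).$$
   Context: $\mathbb{R}_0^+=[0,\infty)$. $S$ is a nonempty, at least countable set, $\mathcal{C}$ is a $\sigma$-algebra of subsets of $S$, and $\mathcal{E}$ is a $\sigma$-algebra of subsets of $\mathbb{R}_0^+$ with $\{0\}\in\mathcal{E}$. Set functions on $\mathcal{C}$ and $\mathcal{E}$ have values in $\mathbb{R}_0^+$, vanish on $\emptyset$, and are not assumed additive or monotone unless stated. Below, $\mu$ denotes any such set function on $\mathcal{C}$. Measurability: $f:S\to\mathbb{R}_0^+$ is $\mu$-measurable if it is $\mathcal{C}$-measurable, i.e. $E_f^\alpha:=\{s\in S: f(s)\ge\alpha\}\in\mathcal{C}$ for all $\alpha\ge 0$. Riemann-Lebesgue (RL) integral: for two countable partitions $P,P'$ of $\mathbb{R}_0^+$, $P'$ is finer than $P$ if every set of $P'$ is included in some set of $P$. A function $g:\mathbb{R}_0^+\to\mathbb{R}$ is $\nu$-RL integrable if there is $a\in\mathbb{R}$ such that for every $\varepsilon>0$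 there is a countable partition $\Pi_\varepsilon$ of $\mathbb{R}_0^+$ into sets of $\mathcal{E}$ such that for every countable partition $\Pi=(E_n)_n$ of $\mathbb{R}_0^+$ into sets of $\mathcal{E}$ finer than $\Pi_\varepsilon$: $g$ is bounded on every $E_n$ with $\nu(E_n)>0$, and for every choice of $s_n\in E_n$ the series $\sum_n g(s_n)\nu(E_n)$ converges absolutely and $|\sum_n g(s_n)\nu(E_n)-a|<\varepsilon$. Then $a$ is unique and is denoted $(RL)\int_{[0,\infty)}g\,d\nu$. Generalized decomposition integral: for a $\mu$-measurable $f:S\to\mathbb{R}_0^+$ and $A\in\mathcal{C}$ put $u_{f,\mu}^{A}(\alpha)=\mu(E_f^\alpha\cap A)$, $\alpha\ge 0$. $f$ is $(\nu,\mu)$-integrable on $A$ if $u_{f,\mu}^A$ is $\nu$-RL integrable on $\mathbb{R}_0^+$, and then $\int_A^{*}f\,d(\nu,\mu):=(RL)\int_{[0,\infty)}u_{f,\mu}^A\,d\nu$. $G_{RL}(\nu,\mu,A)$ is the set of all $\mu$-measurable $f:S\to\mathbb{R}_0^+$ that are $(\nu,\mu)$-integrable on $A$ (with finite integral). *)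

theory Defs
  imports "HOL-Analysis.Analysis"
begin

definition set_function :: "'b set set \<Rightarrow> ('b set \<Rightarrow> real) \<Rightarrow> bool"
  where "set_function M \<mu> \<longleftrightarrow> (\<forall>X\<in>M. 0 \<le> \<mu> X) \<and> \<mu> {} = 0"

definition upper_level_set :: "'a set \<Rightarrow> ('a \<Rightarrow> real) \<Rightarrow> real \<Rightarrow> 'a set"
  where "upper_level_set S f \<alpha> = {s \<in> S. \<alpha> \<le> f s}"

text \<open>Measurability depends only on the \<open>\<sigma>\<close>-algebra, not on the set function \<open>\<mu>\<close>.\<close>

definition level_measurable :: "'a set \<Rightarrow> 'a set set \<Rightarrow> ('a \<Rightarrow> real) \<Rightarrow> bool"
  where "level_measurable S C f \<longleftrightarrow>
    f \<in> S \<rightarrow> {0..} \<and> (\<forall>\<alpha>\<ge>0. upper_level_set S f \<alpha> \<in> C)"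

text \<open>Countable includes finite, and the cells of a partition are nonempty
  (this is part of \<open>partition_on\<close>), so points can always be selected from them.\<close>

definition countable_partition :: "real set set \<Rightarrow> real set set \<Rightarrow> bool"
  where "countable_partition E P \<longleftrightarrow> partition_on {0..} P \<and> countable P \<and> P \<subseteq> E"

text \<open>A partition is an unindexed family of cells, with the selected point of the cell \<open>X\<close>
  written \<open>s X\<close>. As the series over the cells is required to converge absolutely, its value
  does not depend on an enumeration and is given by the unordered sum.\<close>

definition has_RL_integral ::
    "real set set \<Rightarrow> (real set \<Rightarrow> real) \<Rightarrow> (real \<Rightarrow> real) \<Rightarrow> real \<Rightarrow> bool"
  where "has_RL_integral E \<nu> g a \<longleftrightarrow>
    (\<forall>\<epsilon>>0. \<exists>P\<^sub>\<epsilon>. countable_partition E P\<^sub>\<epsilon> \<and>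
      (\<forall>P. countable_partition E P \<and> refines {0..} P P\<^sub>\<epsilon> \<longrightarrow>
        (\<forall>X\<in>P. \<nu> X > 0 \<longrightarrow> bounded (g ` X)) \<and>
        (\<forall>s. (\<forall>X\<in>P. s X \<in> X) \<longrightarrow>
          (\<lambda>X. \<bar>g (s X) * \<nu> X\<bar>) summable_on P \<and>
          \<bar>(\<Sum>\<^sub>\<infinity>X\<in>P. g (s X) * \<nu> X) - a\<bar> < \<epsilon>)))"

definition RL_integrable ::
    "real set set \<Rightarrow> (real set \<Rightarrow> real) \<Rightarrow> (real \<Rightarrow> real) \<Rightarrow> bool"
  where "RL_integrable E \<nu> g \<longleftrightarrow> (\<exists>a. has_RL_integral E \<nu> g a)"

definition RL_integral ::
    "real set set \<Rightarrow> (real set \<Rightarrow> real) \<Rightarrow> (real \<Rightarrow> real) \<Rightarrow> real"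
  where "RL_integral E \<nu> g = (THE a. has_RL_integral E \<nu> g a)"

definition survival_function ::
    "'a set \<Rightarrow> ('a \<Rightarrow> real) \<Rightarrow> ('a set \<Rightarrow> real) \<Rightarrow> 'a set \<Rightarrow> real \<Rightarrow> real"
  where "survival_function S f \<mu> A \<alpha> = \<mu> (upper_level_set S f \<alpha> \<inter> A)"

definition G_RL ::
    "'a set \<Rightarrow> 'a set set \<Rightarrow> real set set \<Rightarrow> (real set \<Rightarrow> real) \<Rightarrow> ('a set \<Rightarrow> real) \<Rightarrow> 'a set \<Rightarrow>
      ('a \<Rightarrow> real) set"
  where "G_RL S C E \<nu> \<mu> A =
    {f. level_measurable S C f \<and> RL_integrable E \<nu> (survival_function S f \<mu> A)}"

definition decomposition_integral ::
    "'a set \<Rightarrow> real set set \<Rightarrow> (real set \<Rightarrow> real) \<Rightarrow> ('a set \<Rightarrow> real) \<Rightarrow> 'a set \<Rightarrow>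
      ('a \<Rightarrow> real) \<Rightarrow> real"
  where "decomposition_integral S E \<nu> \<mu> A f = RL_integral E \<nu> (survival_function S f \<mu> A)"

end

theory Submission
  imports Defs
begin

text \<open>For a fixed level set intersected with \<open>A\<close>, the sum measure evaluates to
  the sum of the two values, so the survival function of \<open>f\<close> is pointwise additive in
  the set function. The theorem therefore reduces to additivity of the RL integral in its integrand,
  with \<nu> fixed (\<open>has_RL_integral_add\<close>). This is an \<epsilon>/2 argument. The RL
  condition holds for every partition finer than some threshold partition, so the thresholds of the
  two integrands can be replaced by one common refinement
  (\<open>countable_partition_common_refinement\<close>). Beyond it both series converge absolutely,
  their sums add up termwise, and the two errors add up to less than \<epsilon>. As the value of the
  integral is given by a definite description, equality of values also needs uniqueness
  (\<open>has_RL_integral_unique\<close>), which rests on common refinements too.\<close>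

text \<open>This makes the countable partitions into sets of \<open>E\<close> a directed family
  under refinement, so the RL integral is a limit along it. The nonempty intersections of a cell of
  \<open>P\<close> with a cell of \<open>Q\<close> serve as cells: they are indexed by pairs, hence
  countably many, and \<open>E\<close> is closed under intersection.\<close>

lemma countable_partition_common_refinement:
  assumes "sigma_algebra {0..} E" "countable_partition E P" "countable_partition E Q"
  obtains R where "countable_partition E R" "refines {0..} R P" "refines {0..} R Q"
proof
  let ?R = "common_refinement {P, Q}"
  have part: "\<And>P'. P' \<in> {P, Q} \<Longrightarrow> partition_on {0..} P'"
    and c: "countable P" "countable Q" and sub: "P \<subseteq> E" "Q \<subseteq> E"
    using assms(2,3) unfolding countable_partition_def by auto
  \<comment> \<open>Only an inclusion is claimed: \<open>common_refinement\<close> discards empty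
    intersections, whereas the image on the right may contain the empty set.\<close>
  have R: "?R \<subseteq> (\<lambda>(X, Y). X \<inter> Y) ` (P \<times> Q)"
    by (auto simp: common_refinement_def PiE_iff)
  have "X \<inter> Y \<in> E" if "X \<in> P" "Y \<in> Q" for X Y
  proof -
    interpret sigma_algebra "{0..}" E by fact
    show ?thesis using that sub by blast
  qed
  then have "?R \<subseteq> E" using R by auto
  moreover have "countable ?R"
    using R c by (meson countable_SIGMA countable_image countable_subset)
  ultimately show "countable_partition E ?R"
    using partition_on_common_refinement[of "{P, Q}", OF part] by (simp add: countable_partition_def)
  show "refines {0..} ?R P" "refines {0..} ?R Q"
    using refines_common_refinement[of "{P, Q}", OF part] by simp_all
qed

text \<open>Repackages the nested quantifiers of the definition as three separate rules about
  partitions finer than the threshold: boundedness, summability and approximation.\<close>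

lemma has_RL_integralD:
  assumes "has_RL_integral E \<nu> g a" "\<epsilon> > 0"
  obtains P where "countable_partition E P"
    "\<And>R X. countable_partition E R \<Longrightarrow> refines {0..} R P \<Longrightarrow> X \<in> R \<Longrightarrow> \<nu> X > 0 \<Longrightarrow> bounded (g ` X)"
    "\<And>R s. countable_partition E R \<Longrightarrow> refines {0..} R P \<Longrightarrow> (\<And>X. X \<in> R \<Longrightarrow> s X \<in> X) \<Longrightarrow>
      (\<lambda>X. \<bar>g (s X) * \<nu> X\<bar>) summable_on R"
    "\<And>R s. countable_partition E R \<Longrightarrow> refines {0..} R P \<Longrightarrow> (\<And>X. X \<in> R \<Longrightarrow> s X \<in> X) \<Longrightarrow>
      \<bar>(\<Sum>\<^sub>\<infinity>X\<in>R. g (s X) * \<nu> X) - a\<bar> < \<epsilon>"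
proof -
  obtain P where P: "countable_partition E P" and
    *: "\<forall>R. countable_partition E R \<and> refines {0..} R P \<longrightarrow>
        (\<forall>X\<in>R. \<nu> X > 0 \<longrightarrow> bounded (g ` X)) \<and>
        (\<forall>s. (\<forall>X\<in>R. s X \<in> X) \<longrightarrow>
          (\<lambda>X. \<bar>g (s X) * \<nu> X\<bar>) summable_on R \<and>
          \<bar>(\<Sum>\<^sub>\<infinity>X\<in>R. g (s X) * \<nu> X) - a\<bar> < \<epsilon>)"
    using assms(1)[unfolded has_RL_integral_def, rule_format, OF assms(2)] by (elim exE conjE)
  show thesis
    by (rule that[OF P]) (simp_all add: *)
qed

text \<open>On a common refinement of two thresholds, a single RL sum is close to both candidate
  values, so they cannot differ.\<close>

lemma has_RL_integral_unique:
  assumes \<sigma>: "sigma_algebra {0..} E"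
    and a: "has_RL_integral E \<nu> g a" and b: "has_RL_integral E \<nu> g b"
  shows "a = b"
proof (rule ccontr)
  assume "a \<noteq> b"
  \<comment> \<open>Half the distance is small enough: no number is strictly within it of both
    \<open>a\<close> and \<open>b\<close>, by the triangle inequality.\<close>
  then have pos: "\<bar>a - b\<bar> / 2 > 0" by simp
  obtain P where P: "countable_partition E P"
    "\<And>R X. countable_partition E R \<Longrightarrow> refines {0..} R P \<Longrightarrow> X \<in> R \<Longrightarrow> \<nu> X > 0 \<Longrightarrow> bounded (g ` X)"
    "\<And>R s. countable_partition E R \<Longrightarrow> refines {0..} R P \<Longrightarrow> (\<And>X. X \<in> R \<Longrightarrow> s X \<in> X) \<Longrightarrow>
      (\<lambda>X. \<bar>g (s X) * \<nu> X\<bar>) summable_on R"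
    "\<And>R s. countable_partition E R \<Longrightarrow> refines {0..} R P \<Longrightarrow> (\<And>X. X \<in> R \<Longrightarrow> s X \<in> X) \<Longrightarrow>
      \<bar>(\<Sum>\<^sub>\<infinity>X\<in>R. g (s X) * \<nu> X) - a\<bar> < \<bar>a - b\<bar> / 2"
    using has_RL_integralD[OF a pos] by blast
  obtain Q where Q: "countable_partition E Q"
    "\<And>R X. countable_partition E R \<Longrightarrow> refines {0..} R Q \<Longrightarrow> X \<in> R \<Longrightarrow> \<nu> X > 0 \<Longrightarrow> bounded (g ` X)"
    "\<And>R s. countable_partition E R \<Longrightarrow> refines {0..} R Q \<Longrightarrow> (\<And>X. X \<in> R \<Longrightarrow> s X \<in> X) \<Longrightarrow>
      (\<lambda>X. \<bar>g (s X) * \<nu> X\<bar>) summable_on R"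
    "\<And>R s. countable_partition E R \<Longrightarrow> refines {0..} R Q \<Longrightarrow> (\<And>X. X \<in> R \<Longrightarrow> s X \<in> X) \<Longrightarrow>
      \<bar>(\<Sum>\<^sub>\<infinity>X\<in>R. g (s X) * \<nu> X) - b\<bar> < \<bar>a - b\<bar> / 2"
    using has_RL_integralD[OF b pos] by blast
  obtain R where R: "countable_partition E R" "refines {0..} R P" "refines {0..} R Q"
    using countable_partition_common_refinement[OF \<sigma> P(1) Q(1)] .
  \<comment> \<open>Cells of a partition are nonempty, so choice provides the one selection of
    points at which both estimates are compared.\<close>
  have s: "(SOME x. x \<in> X) \<in> X" if "X \<in> R" for X
    using R(1) that unfolding countable_partition_def partition_on_def
    by (simp add: some_in_eq) metis
  have "\<bar>(\<Sum>\<^sub>\<infinity>X\<in>R. g (SOME x. x \<in> X) * \<nu> X) - a\<bar> < \<bar>a - b\<bar> / 2"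
    by (rule P(4)[OF R(1,2)]) (rule s)
  moreover have "\<bar>(\<Sum>\<^sub>\<infinity>X\<in>R. g (SOME x. x \<in> X) * \<nu> X) - b\<bar> < \<bar>a - b\<bar> / 2"
    by (rule Q(4)[OF R(1,3)]) (rule s)
  ultimately show False by (auto simp: abs_if split: if_splits)
qed

lemma RL_integral_eqI:
  assumes "sigma_algebra {0..} E" "has_RL_integral E \<nu> g a"
  shows "RL_integral E \<nu> g = a"
  unfolding RL_integral_def using assms has_RL_integral_unique by blast

lemma has_RL_integral_add:
  assumes \<sigma>: "sigma_algebra {0..} E"
    and a: "has_RL_integral E \<nu> g a" and b: "has_RL_integral E \<nu> h b"
  shows "has_RL_integral E \<nu> (\<lambda>x. g x + h x) (a + b)"
  unfolding has_RL_integral_def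
proof (intro allI impI)
  fix \<epsilon> :: real assume "\<epsilon> > 0"
  then have pos: "\<epsilon> / 2 > 0" by simp
  obtain P where P: "countable_partition E P"
    "\<And>R X. countable_partition E R \<Longrightarrow> refines {0..} R P \<Longrightarrow> X \<in> R \<Longrightarrow> \<nu> X > 0 \<Longrightarrow> bounded (g ` X)"
    "\<And>R s. countable_partition E R \<Longrightarrow> refines {0..} R P \<Longrightarrow> (\<And>X. X \<in> R \<Longrightarrow> s X \<in> X) \<Longrightarrow>
      (\<lambda>X. \<bar>g (s X) * \<nu> X\<bar>) summable_on R"
    "\<And>R s. countable_partition E R \<Longrightarrow> refines {0..} R P \<Longrightarrow> (\<And>X. X \<in> R \<Longrightarrow> s X \<in> X) \<Longrightarrow>
      \<bar>(\<Sum>\<^sub>\<infinity>X\<in>R. g (s X) * \<nu> X) - a\<bar> < \<epsilon> / 2"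
    using has_RL_integralD[OF a pos] by blast
  obtain Q where Q: "countable_partition E Q"
    "\<And>R X. countable_partition E R \<Longrightarrow> refines {0..} R Q \<Longrightarrow> X \<in> R \<Longrightarrow> \<nu> X > 0 \<Longrightarrow> bounded (h ` X)"
    "\<And>R s. countable_partition E R \<Longrightarrow> refines {0..} R Q \<Longrightarrow> (\<And>X. X \<in> R \<Longrightarrow> s X \<in> X) \<Longrightarrow>
      (\<lambda>X. \<bar>h (s X) * \<nu> X\<bar>) summable_on R"
    "\<And>R s. countable_partition E R \<Longrightarrow> refines {0..} R Q \<Longrightarrow> (\<And>X. X \<in> R \<Longrightarrow> s X \<in> X) \<Longrightarrow>
      \<bar>(\<Sum>\<^sub>\<infinity>X\<in>R. h (s X) * \<nu> X) - b\<bar> < \<epsilon> / 2"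
    using has_RL_integralD[OF b pos] by blast
  obtain R where R: "countable_partition E R" "refines {0..} R P" "refines {0..} R Q"
    using countable_partition_common_refinement[OF \<sigma> P(1) Q(1)] .
  show "\<exists>P\<^sub>\<epsilon>. countable_partition E P\<^sub>\<epsilon> \<and>
      (\<forall>P. countable_partition E P \<and> refines {0..} P P\<^sub>\<epsilon> \<longrightarrow>
        (\<forall>X\<in>P. \<nu> X > 0 \<longrightarrow> bounded ((\<lambda>x. g x + h x) ` X)) \<and>
        (\<forall>s. (\<forall>X\<in>P. s X \<in> X) \<longrightarrow>
          (\<lambda>X. \<bar>(g (s X) + h (s X)) * \<nu> X\<bar>) summable_on P \<and>
          \<bar>(\<Sum>\<^sub>\<infinity>X\<in>P. (g (s X) + h (s X)) * \<nu> X) - (a + b)\<bar> < \<epsilon>))"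
  \<comment> \<open>The common refinement \<open>R\<close> is the threshold for the sum: by
    transitivity, every partition finer than \<open>R\<close> is finer than both \<open>P\<close>
    and \<open>Q\<close>, so the rules for both integrands apply to it.\<close>
  proof (rule exI[of _ R], intro conjI allI impI ballI R(1); (elim conjE)?)
    fix T X assume T: "countable_partition E T" "refines {0..} T R" and X: "X \<in> T" "\<nu> X > 0"
    have TP: "refines {0..} T P" and TQ: "refines {0..} T Q"
      using T(2) R(2,3) refines_trans by blast+
    show "bounded ((\<lambda>x. g x + h x) ` X)"
      using P(2)[OF T(1) TP X] Q(2)[OF T(1) TQ X] by (rule bounded_plus_comp)
  next
    fix T s assume T: "countable_partition E T" "refines {0..} T R" and "\<forall>X\<in>T. s X \<in> X"
    then have s: "\<And>X. X \<in> T \<Longrightarrow> s X \<in> X" by blast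
    have TP: "refines {0..} T P" and TQ: "refines {0..} T Q"
      using T(2) R(2,3) refines_trans by blast+
    have g: "(\<lambda>X. \<bar>g (s X) * \<nu> X\<bar>) summable_on T" using P(3)[OF T(1) TP s] .
    have h: "(\<lambda>X. \<bar>h (s X) * \<nu> X\<bar>) summable_on T" using Q(3)[OF T(1) TQ s] .
    have g': "(\<lambda>X. g (s X) * \<nu> X) summable_on T"
      and h': "(\<lambda>X. h (s X) * \<nu> X) summable_on T"
      using g h by (auto intro: abs_summable_summable)
    \<comment> \<open>For real families, unordered summability and absolute summability coincide. It
      thus suffices to add the two series without absolute values and convert back, with no
      comparison of absolute values.\<close>
    have "(\<lambda>X. (g (s X) + h (s X)) * \<nu> X) summable_on T"
      using summable_on_add[OF g' h'] by (simp add: distrib_right)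
    then show "(\<lambda>X. \<bar>(g (s X) + h (s X)) * \<nu> X\<bar>) summable_on T"
      by (subst (asm) summable_on_iff_abs_summable_on_real) simp
    have "(\<Sum>\<^sub>\<infinity>X\<in>T. (g (s X) + h (s X)) * \<nu> X) =
        (\<Sum>\<^sub>\<infinity>X\<in>T. g (s X) * \<nu> X) + (\<Sum>\<^sub>\<infinity>X\<in>T. h (s X) * \<nu> X)"
      using infsum_add[OF g' h'] by (simp add: distrib_right)
    then show "\<bar>(\<Sum>\<^sub>\<infinity>X\<in>T. (g (s X) + h (s X)) * \<nu> X) - (a + b)\<bar> < \<epsilon>"
      using P(4)[OF T(1) TP s] Q(4)[OF T(1) TQ s] by linarith
  qed
qed

theorem proposition3p16:
  fixes S :: "'a set" and C :: "'a set set" and E :: "real set set"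
    and \<mu>\<^sub>1 \<mu>\<^sub>2 :: "'a set \<Rightarrow> real" and \<nu> :: "real set \<Rightarrow> real"
    and f :: "'a \<Rightarrow> real" and A :: "'a set"
  assumes "infinite S"
    and "sigma_algebra S C"
    and "sigma_algebra {0..} E" and "{0} \<in> E"
    and "set_function C \<mu>\<^sub>1" and "set_function C \<mu>\<^sub>2" and "set_function E \<nu>"
    and "level_measurable S C f"
    and "A \<in> C"
    and "f \<in> G_RL S C E \<nu> \<mu>\<^sub>1 A" and "f \<in> G_RL S C E \<nu> \<mu>\<^sub>2 A"
  shows "f \<in> G_RL S C E \<nu> (\<lambda>X. \<mu>\<^sub>1 X + \<mu>\<^sub>2 X) A \<and>
    decomposition_integral S E \<nu> (\<lambda>X. \<mu>\<^sub>1 X + \<mu>\<^sub>2 X) A f =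
      decomposition_integral S E \<nu> \<mu>\<^sub>1 A f + decomposition_integral S E \<nu> \<mu>\<^sub>2 A f"
proof -
  note \<sigma> = \<open>sigma_algebra {0..} E\<close>
  obtain a b where a: "has_RL_integral E \<nu> (survival_function S f \<mu>\<^sub>1 A) a"
    and b: "has_RL_integral E \<nu> (survival_function S f \<mu>\<^sub>2 A) b"
    using assms(10,11) unfolding G_RL_def RL_integrable_def by blast
  have "survival_function S f (\<lambda>X. \<mu>\<^sub>1 X + \<mu>\<^sub>2 X) A =
      (\<lambda>\<alpha>. survival_function S f \<mu>\<^sub>1 A \<alpha> + survival_function S f \<mu>\<^sub>2 A \<alpha>)"
    by (simp add: survival_function_def fun_eq_iff)
  then have ab: "has_RL_integral E \<nu> (survival_function S f (\<lambda>X. \<mu>\<^sub>1 X + \<mu>\<^sub>2 X) A) (a + b)"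
    using has_RL_integral_add[OF \<sigma> a b] by simp
  \<comment> \<open>Measurability refers only to \<open>C\<close>, so it carries over to the sum of
    the set functions; uniqueness identifies the three integrals with \<open>a\<close>,
    \<open>b\<close> and \<open>a + b\<close>.\<close>
  then show ?thesis
    using \<open>level_measurable S C f\<close> RL_integral_eqI[OF \<sigma> a] RL_integral_eqI[OF \<sigma> b]
      RL_integral_eqI[OF \<sigma> ab]
    unfolding G_RL_def RL_integrable_def decomposition_integral_def by auto
qed

end
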